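(* Let $G$ be a graph without isolated vertices, with $m\ge1$ edges and spectral radius $\lambda\ge\sqrt m$. Then $$\operatorname{bk}(G)\ \ge\ \lambda-\frac{2m}{3\lambda},$$ unless $G$ is a complete bipartite graph.
   Context: Graphs are finite and simple. The spectral radius of $G$ is the spectral radius of its adjacency matrix. The booksize is $\operatorname{bk}(G)=\max_{uv\in E(G)}|N(u)\cap N(v)|$, the maximum number of triangles sharing a common edge. *)

theory Defs
  imports
    "Graph_Theory.Kuratowski"
    "Jordan_Normal_Form.Spectral_Radius"
begin

text \<open>
  Finite simple graphs are the locale \<^locale>\<open>graph\<close>: finite, loop-free, symmetric digraphs
  without multiple arcs.  Each undirected edge is thus a pair of opposite arcs, so edges are
  counted as two-element sets of end points, not as arcs.
\<close>

definition uedges :: "('a, 'b) pre_digraph \<Rightarrow> 'a set set" where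
  "uedges G = {{u, v} | u v. u \<rightarrow>\<^bsub>G\<^esub> v}"

definition nbrs :: "('a, 'b) pre_digraph \<Rightarrow> 'a \<Rightarrow> 'a set" where
  "nbrs G v = {w. v \<rightarrow>\<^bsub>G\<^esub> w}"

text \<open>Only meaningful for finite graphs with at least one edge (\<^const>\<open>Max\<close> of a nonempty set).\<close>

definition booksize :: "('a, 'b) pre_digraph \<Rightarrow> nat" where
  "booksize G = Max {card (nbrs G u \<inter> nbrs G v) | u v. u \<rightarrow>\<^bsub>G\<^esub> v}"

text \<open>
  The adjacency matrix with respect to an enumeration \<open>f\<close> of the vertices by \<open>0, \<dots>, n - 1\<close>.
  Its entries are complex because \<^const>\<open>spectral_radius\<close> is defined for complex matrices.
\<close>

definition adjacency_matrix :: "('a, 'b) pre_digraph \<Rightarrow> (nat \<Rightarrow> 'a) \<Rightarrow> complex mat" where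
  "adjacency_matrix G f =
     mat (card (verts G)) (card (verts G)) (\<lambda>(i, j). if f i \<rightarrow>\<^bsub>G\<^esub> f j then 1 else 0)"

text \<open>
  The enumeration is chosen arbitrarily; \<open>graph_spectral_radius_eq\<close> below shows that the choice
  does not matter.
\<close>

definition graph_spectral_radius :: "('a, 'b) pre_digraph \<Rightarrow> real" where
  "graph_spectral_radius G =
     spectral_radius (adjacency_matrix G (SOME f. bij_betw f {..<card (verts G)} (verts G)))"

lemma spectrum_adjacency_matrix_subset:
  assumes f: "bij_betw f {..<card (verts G)} (verts G)"
    and g: "bij_betw g {..<card (verts G)} (verts G)"
  shows "spectrum (adjacency_matrix G f) \<subseteq> spectrum (adjacency_matrix G g)"
proof
  fix k assume "k \<in> spectrum (adjacency_matrix G f)"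
  define n where "n = card (verts G)"
  define p where "p i = inv_into {..<n} f (g i)" for i
  from f g have p: "bij_betw p {..<n} {..<n}"
    unfolding p_def n_def
    using bij_betw_trans[OF g bij_betw_inv_into[OF f]] by (simp add: comp_def)
  have fp: "f (p i) = g i" if "i < n" for i
    unfolding p_def using f g that
    by (metis bij_betw_apply bij_betw_inv_into_right lessThan_iff n_def)
  have pn: "p i < n" if "i < n" for i
    using p that by (auto simp: bij_betw_def)
  from \<open>k \<in> _\<close> obtain v where v: "v \<in> carrier_vec n" "v \<noteq> 0\<^sub>v n"
    and ev: "adjacency_matrix G f *\<^sub>v v = k \<cdot>\<^sub>v v"
    by (auto simp: spectrum_def eigenvalue_def eigenvector_def adjacency_matrix_def n_def)
  have evi: "(\<Sum>j<n. (if f i \<rightarrow>\<^bsub>G\<^esub> f j then 1 else 0) * v $ j) = k * v $ i" if "i < n" for i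
  proof -
    have "(adjacency_matrix G f *\<^sub>v v) $ i = (k \<cdot>\<^sub>v v) $ i" using ev by simp
    with that v(1) show ?thesis
      by (simp add: adjacency_matrix_def scalar_prod_def n_def atLeast0LessThan)
  qed
  define w where "w = vec n (\<lambda>i. v $ p i)"
  have "adjacency_matrix G g *\<^sub>v w = k \<cdot>\<^sub>v w"
  proof (rule eq_vecI)
    fix i assume "i < dim_vec (k \<cdot>\<^sub>v w)"
    then have i: "i < n" by (simp add: w_def)
    have "(adjacency_matrix G g *\<^sub>v w) $ i
        = (\<Sum>j<n. (if g i \<rightarrow>\<^bsub>G\<^esub> g j then 1 else 0) * v $ p j)"
      using i by (simp add: adjacency_matrix_def scalar_prod_def n_def w_def atLeast0LessThan)
    also have "\<dots> = (\<Sum>j<n. (if f (p i) \<rightarrow>\<^bsub>G\<^esub> f (p j) then 1 else 0) * v $ p j)"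
      using i fp by (intro sum.cong) auto
    also have "\<dots> = (\<Sum>j<n. (if f (p i) \<rightarrow>\<^bsub>G\<^esub> f j then 1 else 0) * v $ j)"
      by (rule sum.reindex_bij_betw[OF p])
    also have "\<dots> = k * v $ p i" by (rule evi[OF pn[OF i]])
    finally show "(adjacency_matrix G g *\<^sub>v w) $ i = (k \<cdot>\<^sub>v w) $ i"
      using i by (simp add: w_def)
  qed (simp add: adjacency_matrix_def w_def n_def)
  moreover have "w \<noteq> 0\<^sub>v n"
  proof
    assume w0: "w = 0\<^sub>v n"
    have "v $ j = 0" if j: "j < n" for j
    proof -
      obtain i where i: "i < n" "p i = j"
        using p j by (metis bij_betw_iff_bijections lessThan_iff)
      have "w $ i = 0" using w0 i(1) by simp
      with i show ?thesis by (simp add: w_def)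
    qed
    with v show False by auto
  qed
  ultimately show "k \<in> spectrum (adjacency_matrix G g)"
    by (auto simp: spectrum_def eigenvalue_def eigenvector_def adjacency_matrix_def n_def w_def
        intro!: exI[of _ w])
qed

lemma graph_spectral_radius_eq:
  assumes "bij_betw f {..<card (verts G)} (verts G)"
  shows "graph_spectral_radius G = spectral_radius (adjacency_matrix G f)"
proof -
  let ?P = "\<lambda>f. bij_betw f {..<card (verts G)} (verts G)"
  have "?P (SOME f. ?P f)" using assms by (rule someI[of ?P])
  with assms have "spectrum (adjacency_matrix G (SOME f. ?P f)) = spectrum (adjacency_matrix G f)"
    by (intro equalityI spectrum_adjacency_matrix_subset)
  then show ?thesis by (simp add: graph_spectral_radius_def spectral_radius_def)
qed

end

theory Submission
  imports Defs "HOL-Analysis.Function_Topology"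
begin

text \<open>
  Let \<open>x\<close> be a nonnegative eigenvector for \<open>\<lambda>\<close> with entries summing to 1, and cut the graph between
  \<open>N(z)\<close> and its complement, with \<open>z\<close> drawn with probability \<open>x z\<close>. An edge \<open>uv\<close> is uncut with
  probability \<open>U(uv) = 1 - \<lambda>(x u + x v) + 2 x(N(u) \<inter> N(v))\<close>, and every triangle has an uncut edge, so
  the values of \<open>U\<close> on its three edges sum to at least 1. Let \<open>c(uv)\<close> be the number of common
  neighbours. Summing over edges and triangles gives, for each real \<open>B\<close>,
  \<open>(\<Sum>uv. (B - c(uv)) (B (x u + x v) - 1/3 + U(uv))) \<le> B (2m/3 - \<lambda>(\<lambda> - B))\<close>.
  If \<open>B \<ge> \<lambda>/3\<close> and \<open>B \<ge> c\<close>, the left-hand side is nonnegative, because \<open>U \<ge> 0\<close> and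
  \<open>U(uv) \<ge> 1 - \<lambda>(x u + x v)\<close>. For booksize at least \<open>\<lambda>/3\<close>, taking \<open>B\<close> to be the booksize gives the
  theorem. Otherwise \<open>B = \<lambda>/3\<close> and \<open>\<lambda>\<^sup>2 \<ge> m\<close> force equality everywhere, so \<open>U = 0\<close> and
  \<open>\<lambda>(x u + x v) = 1\<close> on every edge: \<open>x\<close> is positive and each \<open>N(z)\<close> cuts all edges, which makes the
  graph complete bipartite.
\<close>

subsection \<open>A nonnegative eigenvector for the largest eigenvalue\<close>

text \<open>Functions carry the product topology, so a box of compact factors is compact by
  Tychonoff. Pinning the coordinates outside \<open>V\<close> to 0 keeps the set inside such a box
  even when the type is infinite.\<close>

lemma compact_nonneg_sphere:
  assumes "finite V"
  shows "compact {x :: 'a \<Rightarrow> real. (\<forall>v \<in> V. 0 \<le> x v) \<and> (\<forall>v. v \<notin> V \<longrightarrow> x v = 0) \<and> (\<Sum>v\<in>V. (x v)\<^sup>2) = 1}"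
    (is "compact ?K")
proof -
  let ?box = "PiE UNIV (\<lambda>v. if v \<in> V then {0..1} else {0}) :: ('a \<Rightarrow> real) set"
  have "compactin (product_topology (\<lambda>_. euclidean) UNIV) ?box"
    by (subst compactin_PiE) auto
  then have "compact ?box"
    by (simp add: euclidean_product_topology)
  moreover have "closed {x :: 'a \<Rightarrow> real. (\<Sum>v\<in>V. (x v)\<^sup>2) = 1}"
    by (intro closed_Collect_eq continuous_intros continuous_on_product_coordinates)
  ultimately have "compact (?box \<inter> {x. (\<Sum>v\<in>V. (x v)\<^sup>2) = 1})"
    by (rule compact_Int_closed)
  moreover have "?box \<inter> {x. (\<Sum>v\<in>V. (x v)\<^sup>2) = 1} = ?K"
  proof (intro equalityI subsetI)
    fix x assume x: "x \<in> ?K"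
    have "x v \<le> 1" if "v \<in> V" for v
    proof -
      have "(x v)\<^sup>2 \<le> (\<Sum>v\<in>V. (x v)\<^sup>2)"
        using assms that by (intro member_le_sum) auto
      then show ?thesis using x by (simp add: power_le_one_iff abs_square_le_1)
    qed
    then show "x \<in> ?box \<inter> {x. (\<Sum>v\<in>V. (x v)\<^sup>2) = 1}"
      using x by (auto simp: PiE_iff)
  next
    fix x assume x: "x \<in> ?box \<inter> {x. (\<Sum>v\<in>V. (x v)\<^sup>2) = 1}"
    then have "x v \<in> (if v \<in> V then {0..1} else {0})" for v by blast
    then have "v \<in> V \<Longrightarrow> 0 \<le> x v" "v \<notin> V \<Longrightarrow> x v = 0" for v
      by (metis atLeastAtMost_iff, metis singletonD)
    then show "x \<in> ?K" using x by blast
  qed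
  ultimately show ?thesis by simp
qed

text \<open>\<open>x\<close> maximises the quadratic form on the nonnegative part of the unit
  sphere, and \<mu> is the maximum. Passing to absolute values extends the bound to every
  \<open>y\<close>; a first-order variation then gives the eigenvalue equation.\<close>

lemma nonneg_symmetric_max_eigenvector:
  fixes a :: "'a \<Rightarrow> 'a \<Rightarrow> real"
  assumes fin: "finite V" and "V \<noteq> {}"
    and nonneg: "\<And>u v. 0 \<le> a u v" and sym: "\<And>u v. a u v = a v u"
  obtains x \<mu> where "\<And>v. v \<in> V \<Longrightarrow> 0 \<le> x v" and "(\<Sum>v\<in>V. (x v)\<^sup>2) = 1"
    and "\<And>u. u \<in> V \<Longrightarrow> (\<Sum>v\<in>V. a u v * x v) = \<mu> * x u"
    and "\<And>y. (\<Sum>u\<in>V. \<Sum>v\<in>V. a u v * (y u * y v)) \<le> \<mu> * (\<Sum>v\<in>V. (y v)\<^sup>2)"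
proof -
  define K where "K = {x :: 'a \<Rightarrow> real. (\<forall>v \<in> V. 0 \<le> x v) \<and> (\<forall>v. v \<notin> V \<longrightarrow> x v = 0) \<and> (\<Sum>v\<in>V. (x v)\<^sup>2) = 1}"
  define Q where "Q y = (\<Sum>u\<in>V. \<Sum>v\<in>V. a u v * (y u * y v))" for y
  define S where "S y = (\<Sum>v\<in>V. (y v)\<^sup>2)" for y :: "'a \<Rightarrow> real"
  obtain v0 where "v0 \<in> V" using \<open>V \<noteq> {}\<close> by blast
  then have "(\<lambda>v. if v = v0 then 1 else 0) \<in> K"
    using fin by (auto simp: K_def if_distrib[of "\<lambda>t. t\<^sup>2"] cong: if_cong)
  then have "K \<noteq> {}" by blast
  moreover have "continuous_on K Q"
    unfolding Q_def[abs_def]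
    by (rule continuous_on_subset[OF _ subset_UNIV])
      (intro continuous_on_sum continuous_on_mult continuous_on_const continuous_on_product_coordinates)
  moreover have "compact K"
    unfolding K_def by (rule compact_nonneg_sphere[OF fin])
  ultimately obtain x where x: "x \<in> K" and max: "\<And>y. y \<in> K \<Longrightarrow> Q y \<le> Q x"
    using continuous_attains_sup[of K Q] by blast
  have Q_le: "Q y \<le> Q x * S y" for y
  proof (cases "S y = 0")
    case True
    then have "\<And>v. v \<in> V \<Longrightarrow> y v = 0"
      using fin by (simp add: S_def sum_nonneg_eq_0_iff)
    then show ?thesis by (simp add: Q_def True)
  next
    case False
    then have pos: "S y > 0"
      by (simp add: S_def order_less_le sum_nonneg)
    \<comment> \<open>Replacing \<open>y\<close> by its normalised absolute values lands in
      \<open>K\<close> and, since \<open>a\<close> is nonnegative, does not decrease the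
      form.\<close>
    define z where "z v = (if v \<in> V then \<bar>y v\<bar> / sqrt (S y) else 0)" for v
    have "(\<Sum>v\<in>V. (z v)\<^sup>2) = (\<Sum>v\<in>V. (y v)\<^sup>2 / S y)"
      using pos by (simp add: z_def power_divide)
    also have "\<dots> = 1"
      using pos by (simp add: sum_divide_distrib[symmetric] S_def[symmetric])
    finally have "z \<in> K" using pos by (auto simp: z_def K_def)
    then have "Q z \<le> Q x" by (rule max)
    have "Q y \<le> (\<Sum>u\<in>V. \<Sum>v\<in>V. a u v * (\<bar>y u\<bar> * \<bar>y v\<bar>))"
      unfolding Q_def
      by (intro sum_mono mult_left_mono nonneg) (metis abs_ge_self abs_mult)
    also have "\<dots> = Q z * S y"
      using pos by (simp add: Q_def z_def sum_distrib_right) 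
    also have "\<dots> \<le> Q x * S y" using \<open>Q z \<le> Q x\<close> pos by simp
    finally show ?thesis .
  qed
  define Ax where "Ax u = (\<Sum>v\<in>V. a u v * x v)" for u
  \<comment> \<open>The residual of the eigenvalue equation serves as the direction of variation:
    along it the first-order gain of \<open>Q - Q x * S\<close> is \<open>2 * e * S r\<close>, which
    must be absorbed by an \<open>e\<^sup>2\<close> term.\<close>
  define r where "r u = (if u \<in> V then Ax u - Q x * x u else 0)" for u
  have S1: "S x = 1" using x by (simp add: K_def S_def)
  have Qe: "Q (\<lambda>u. x u + e * r u) = Q x + 2 * e * (\<Sum>u\<in>V. r u * Ax u) + e\<^sup>2 * Q r" for e
  proof -
    have "Q (\<lambda>u. x u + e * r u) = Q x + e * (\<Sum>u\<in>V. \<Sum>v\<in>V. a u v * (r u * x v))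
        + e * (\<Sum>u\<in>V. \<Sum>v\<in>V. a u v * (x u * r v)) + e\<^sup>2 * Q r"
      unfolding Q_def sum_distrib_left sum.distrib[symmetric]
      by (intro sum.cong refl) (simp add: algebra_simps power2_eq_square)
    moreover have "(\<Sum>u\<in>V. \<Sum>v\<in>V. a u v * (x u * r v)) = (\<Sum>u\<in>V. \<Sum>v\<in>V. a u v * (r u * x v))"
      by (subst sum.swap, intro sum.cong refl) (metis sym mult.commute)
    moreover have "(\<Sum>u\<in>V. \<Sum>v\<in>V. a u v * (r u * x v)) = (\<Sum>u\<in>V. r u * Ax u)"
      by (simp add: Ax_def sum_distrib_left mult_ac)
    ultimately show ?thesis by simp
  qed
  have Se: "S (\<lambda>u. x u + e * r u) = 1 + 2 * e * (\<Sum>u\<in>V. r u * x u) + e\<^sup>2 * S r" for e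
    unfolding S1[symmetric] unfolding S_def sum_distrib_left sum.distrib[symmetric]
    by (intro sum.cong refl) (simp add: algebra_simps power2_eq_square)
  have Sr: "S r = (\<Sum>u\<in>V. r u * Ax u) - Q x * (\<Sum>u\<in>V. r u * x u)"
    unfolding S_def sum_distrib_left sum_subtractf[symmetric]
    by (intro sum.cong refl) (simp add: r_def algebra_simps power2_eq_square)
  have key: "2 * e * S r \<le> e\<^sup>2 * (Q x * S r - Q r)" for e
    using Q_le[of "\<lambda>u. x u + e * r u"] unfolding Qe Se Sr
    by (simp add: algebra_simps)
  have "S r = 0"
  proof (rule ccontr)
    assume "S r \<noteq> 0"
    then have pos: "S r > 0" by (simp add: S_def order_less_le sum_nonneg)
    \<comment> \<open>The lower bound 1 keeps \<open>C\<close> positive; with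
      \<open>e = S r / C\<close> the inequality \<open>key\<close> becomes
      \<open>2 * e * S r \<le> e * S r\<close>.\<close>
    define C where "C = max 1 (Q x * S r - Q r)"
    have C: "C > 0" "Q x * S r - Q r \<le> C" by (auto simp: C_def)
    let ?e = "S r / C"
    have "2 * ?e * S r \<le> ?e\<^sup>2 * C"
      using key[of ?e] C(2) by (meson mult_left_mono order_trans zero_le_power2)
    also have "\<dots> = ?e * S r" using C(1) by (simp add: power2_eq_square)
    finally show False using pos C(1) by (simp add: field_simps)
  qed
  then have "\<And>u. u \<in> V \<Longrightarrow> r u = 0"
    using fin by (simp add: S_def sum_nonneg_eq_0_iff)
  then have "\<And>u. u \<in> V \<Longrightarrow> (\<Sum>v\<in>V. a u v * x v) = Q x * x u"
    by (simp add: r_def Ax_def)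
  with x Q_le show thesis
    by (intro that[of x "Q x"]) (auto simp: K_def Q_def S_def)
qed

subsection \<open>Random neighbourhood cuts\<close>

locale perron_weights =
  fixes V :: "'a set" and adj :: "'a \<Rightarrow> 'a \<Rightarrow> bool" and x :: "'a \<Rightarrow> real" and \<mu> :: real
  assumes fin: "finite V"
    and adj_sym: "adj u v \<Longrightarrow> adj v u"
    and adj_in: "adj u v \<Longrightarrow> u \<in> V"
    and x_nonneg: "v \<in> V \<Longrightarrow> 0 \<le> x v"
    and x_sum: "(\<Sum>v\<in>V. x v) = 1"
    and eigen: "u \<in> V \<Longrightarrow> (\<Sum>v\<in>V. of_bool (adj u v) * x v) = \<mu> * x u"
begin

definition codeg :: "'a \<Rightarrow> 'a \<Rightarrow> real" where
  "codeg u v = card {w. adj u w \<and> adj v w}"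

text \<open>The weight of the vertices \<open>z\<close> for which the cut between \<open>N(z)\<close> and its complement
  does not separate \<open>u\<close> from \<open>v\<close>.\<close>

definition uncut :: "'a \<Rightarrow> 'a \<Rightarrow> real" where
  "uncut u v = (\<Sum>z\<in>V. of_bool (adj u z = adj v z) * x z)"

text \<open>Ordered pairs are summed, so an edge counts twice here and a triangle six times in
  \<open>tri_sum\<close>; symmetry of the sums becomes a mere renaming of variables.\<close>

definition arc_sum :: "('a \<Rightarrow> 'a \<Rightarrow> real) \<Rightarrow> real" where
  "arc_sum f = (\<Sum>u\<in>V. \<Sum>v\<in>V. of_bool (adj u v) * f u v)"

definition tri_sum :: "('a \<Rightarrow> 'a \<Rightarrow> 'a \<Rightarrow> real) \<Rightarrow> real" where
  "tri_sum f = (\<Sum>u\<in>V. \<Sum>v\<in>V. \<Sum>w\<in>V. of_bool (adj u v \<and> adj u w \<and> adj v w) * f u v w)"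

section \<open>Linearity and symmetry of arc and triangle sums\<close>

lemma adj_commute: "adj u v \<longleftrightarrow> adj v u"
  using adj_sym by blast

lemma arc_sum_add: "arc_sum (\<lambda>u v. f u v + g u v) = arc_sum f + arc_sum g"
  by (simp add: arc_sum_def sum.distrib algebra_simps)

lemma arc_sum_diff: "arc_sum (\<lambda>u v. f u v - g u v) = arc_sum f - arc_sum g"
  by (simp add: arc_sum_def sum_subtractf algebra_simps)

lemma arc_sum_scale: "arc_sum (\<lambda>u v. c * f u v) = c * arc_sum f"
  by (simp add: arc_sum_def sum_distrib_left mult_ac)

lemma arc_sum_swap: "arc_sum (\<lambda>u v. f v u) = arc_sum f"
  unfolding arc_sum_def by (subst sum.swap) (simp add: adj_commute)

lemma arc_sum_nonneg_eq_0:
  assumes "\<And>u v. adj u v \<Longrightarrow> 0 \<le> f u v" and "arc_sum f \<le> 0" and "adj u v"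
  shows "f u v = 0"
proof -
  have nn: "0 \<le> of_bool (adj u v) * f u v" for u v
    using assms(1) by simp
  have "arc_sum f = 0"
    using assms(2) unfolding arc_sum_def by (intro antisym sum_nonneg nn)
  moreover have uv: "u \<in> V" "v \<in> V" using assms(3) adj_in adj_sym by blast+
  ultimately have "(\<Sum>v\<in>V. of_bool (adj u v) * f u v) = 0"
    using fin unfolding arc_sum_def by (subst (asm) sum_nonneg_eq_0_iff) (auto intro!: sum_nonneg assms(1))
  then have "of_bool (adj u v) * f u v = 0"
    using fin uv by (subst (asm) sum_nonneg_eq_0_iff) (auto intro!: assms(1))
  then show ?thesis using assms(3) by simp
qed

lemma tri_sum_add: "tri_sum (\<lambda>u v w. f u v w + g u v w) = tri_sum f + tri_sum g"
  by (simp add: tri_sum_def sum.distrib algebra_simps)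

lemma tri_sum_swap12: "tri_sum (\<lambda>u v w. f v u w) = tri_sum f"
  unfolding tri_sum_def
  by (subst sum.swap, intro sum.cong refl) (simp add: adj_commute conj_ac)

lemma tri_sum_swap23: "tri_sum (\<lambda>u v w. f u w v) = tri_sum f"
  unfolding tri_sum_def
  by (rule sum.cong[OF refl], rule trans[OF sum.swap], intro sum.cong refl) (simp add: adj_commute conj_ac)

lemma tri_sum_mono:
  assumes "\<And>u v w. adj u v \<Longrightarrow> adj u w \<Longrightarrow> adj v w \<Longrightarrow> f u v w \<le> g u v w"
  shows "tri_sum f \<le> tri_sum g"
  unfolding tri_sum_def by (intro sum_mono) (simp add: assms)

lemma codeg_eq: "codeg u v = (\<Sum>w\<in>V. of_bool (adj u w \<and> adj v w))"
proof -
  have "{w. adj u w \<and> adj v w} = {w \<in> V. adj u w \<and> adj v w}"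
    using adj_in adj_sym by blast
  then show ?thesis using fin by (simp add: codeg_def Int_def)
qed

lemma tri_sum_eq_codeg: "tri_sum (\<lambda>u v w. f u v) = arc_sum (\<lambda>u v. f u v * codeg u v)"
  unfolding tri_sum_def arc_sum_def codeg_eq sum_distrib_left
  by (intro sum.cong refl) simp

section \<open>Bounds on the uncut weight\<close>

lemma uncut_nonneg: "0 \<le> uncut u v"
  unfolding uncut_def by (intro sum_nonneg) (simp add: x_nonneg)

text \<open>For 0/1 values p and q, the indicator of p = q is 1 - p - q + 2pq. After weighting by
  \<open>x\<close>, the eigenvalue equation at \<open>u\<close> and \<open>v\<close> evaluates the
  linear terms.\<close>

lemma uncut_eq:
  assumes "u \<in> V" "v \<in> V"
  shows "uncut u v = 1 - \<mu> * (x u + x v) + 2 * (\<Sum>w\<in>V. of_bool (adj u w \<and> adj v w) * x w)"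
proof -
  have "uncut u v = (\<Sum>w\<in>V. x w - (of_bool (adj u w) * x w + of_bool (adj v w) * x w)
      + 2 * (of_bool (adj u w \<and> adj v w) * x w))"
    unfolding uncut_def by (intro sum.cong refl) simp
  also have "\<dots> = 1 - \<mu> * (x u + x v) + 2 * (\<Sum>w\<in>V. of_bool (adj u w \<and> adj v w) * x w)"
    using assms by (simp only: sum.distrib sum_subtractf x_sum eigen sum_distrib_left distrib_left)
  finally show ?thesis .
qed

lemma uncut_ge: "1 - \<mu> * (x u + x v) \<le> uncut u v" if "u \<in> V" "v \<in> V"
  using that by (simp add: uncut_eq sum_nonneg x_nonneg)

text \<open>Pigeonhole: two of the three vertices of a triangle lie on the same side of each cut.\<close>

lemma uncut_triangle: "1 \<le> uncut u v + uncut u w + uncut v w"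
proof -
  have "(\<Sum>z\<in>V. x z) \<le> (\<Sum>z\<in>V. of_bool (adj u z = adj v z) * x z
      + of_bool (adj u z = adj w z) * x z + of_bool (adj v z = adj w z) * x z)"
    by (intro sum_mono) (auto simp: x_nonneg)
  then show ?thesis by (simp add: uncut_def sum.distrib x_sum)
qed

section \<open>Summation over all edges and triangles\<close>

lemma arc_sum_x: "arc_sum (\<lambda>u v. x u + x v) = 2 * \<mu>"
proof -
  have "arc_sum (\<lambda>u v. x v) = \<mu>"
    unfolding arc_sum_def by (simp add: eigen sum_distrib_left[symmetric] x_sum)
  then show ?thesis using arc_sum_swap[of "\<lambda>u v. x v"] by (simp add: arc_sum_add)
qed

text \<open>The common-neighbour term of \<open>uncut_eq\<close> weighs each triangle by the vertex
  opposite the arc. By symmetry of \<open>tri_sum\<close>, twice this is the same sum weighted by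
  the two ends of the arc.\<close>

lemma arc_sum_uncut:
  "arc_sum uncut = arc_sum (\<lambda>u v. 1 - \<mu> * (x u + x v) + (x u + x v) * codeg u v)"
proof -
  have "arc_sum uncut = arc_sum (\<lambda>u v. 1 - \<mu> * (x u + x v)
      + 2 * (\<Sum>w\<in>V. of_bool (adj u w \<and> adj v w) * x w))"
    unfolding arc_sum_def by (intro sum.cong refl) (simp add: uncut_eq)
  moreover have "arc_sum (\<lambda>u v. 2 * (\<Sum>w\<in>V. of_bool (adj u w \<and> adj v w) * x w)) = 2 * tri_sum (\<lambda>u v w. x w)"
    unfolding arc_sum_def tri_sum_def sum_distrib_left by (intro sum.cong refl) simp
  moreover have "arc_sum (\<lambda>u v. (x u + x v) * codeg u v) = 2 * tri_sum (\<lambda>u v w. x w)"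
    using tri_sum_swap12[of "\<lambda>u v w. x u"] tri_sum_swap23[of "\<lambda>u v w. x w"]
    by (simp add: tri_sum_eq_codeg[symmetric] tri_sum_add)
  ultimately show ?thesis by (simp add: arc_sum_add)
qed

text \<open>Summing \<open>uncut_triangle\<close> over all ordered triangles gives three terms that
  are equal by symmetry.\<close>

lemma arc_sum_codeg_le: "arc_sum codeg \<le> 3 * arc_sum (\<lambda>u v. uncut u v * codeg u v)"
proof -
  have "arc_sum codeg = tri_sum (\<lambda>u v w. 1)"
    using tri_sum_eq_codeg[of "\<lambda>u v. 1"] by simp
  also have "\<dots> \<le> tri_sum (\<lambda>u v w. uncut u v + uncut u w + uncut v w)"
    by (intro tri_sum_mono uncut_triangle)
  also have "\<dots> = 3 * arc_sum (\<lambda>u v. uncut u v * codeg u v)"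
    using tri_sum_swap23[of "\<lambda>u v w. uncut u v"] tri_sum_swap12[of "\<lambda>u v w. uncut u w"]
    by (simp add: tri_sum_add tri_sum_eq_codeg)
  finally show ?thesis .
qed

text \<open>The product is shaped for cancellation: the factor \<open>B\<close> on
  \<open>x u + x v\<close> removes the mixed term with \<open>codeg\<close> that comes from
  \<open>arc_sum_uncut\<close>, and the constant 1/3 leaves exactly the difference bounded by
  \<open>arc_sum_codeg_le\<close>.\<close>

lemma arc_sum_slack_le:
  "arc_sum (\<lambda>u v. (B - codeg u v) * (B * (x u + x v) - 1/3 + uncut u v))
    \<le> B * (2/3 * arc_sum (\<lambda>u v. 1) - 2 * \<mu> * (\<mu> - B))"
proof -
  let ?s = "\<lambda>u v. x u + x v"
  have "arc_sum (\<lambda>u v. (B - codeg u v) * (B * ?s u v - 1/3 + uncut u v))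
      = arc_sum (\<lambda>u v. B * B * ?s u v - B * (1/3) * 1 + B * uncut u v - B * (?s u v * codeg u v)
          + 1/3 * codeg u v - 1 * (uncut u v * codeg u v))"
    by (simp add: algebra_simps)
  also have "\<dots> = B * B * (2 * \<mu>) - B * (1/3) * arc_sum (\<lambda>u v. 1) + B * arc_sum uncut
      - B * arc_sum (\<lambda>u v. ?s u v * codeg u v) + 1/3 * arc_sum codeg
      - arc_sum (\<lambda>u v. uncut u v * codeg u v)"
    by (simp only: arc_sum_add arc_sum_diff arc_sum_scale arc_sum_x[unfolded arc_sum_add])
  also have "arc_sum uncut = arc_sum (\<lambda>u v. 1) - \<mu> * (2 * \<mu>) + arc_sum (\<lambda>u v. ?s u v * codeg u v)"
    by (simp only: arc_sum_uncut arc_sum_add arc_sum_diff arc_sum_scale arc_sum_x[unfolded arc_sum_add])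
  finally show ?thesis
    using arc_sum_codeg_le by (simp add: algebra_simps)
qed

text \<open>With t = 1 - \<mu> (x u + x v), the expression is at least \<open>uncut u v\<close> -
  t/3. If t is at most 0, \<open>uncut_nonneg\<close> suffices; otherwise \<open>uncut u v\<close>
  is at least t.\<close>

lemma local_slack_nonneg:
  assumes "u \<in> V" "v \<in> V" and "0 < \<mu>" "\<mu> / 3 \<le> B"
  shows "0 \<le> B * (x u + x v) - 1/3 + uncut u v"
proof (cases "1 \<le> \<mu> * (x u + x v)")
  case True
  have "\<mu> / 3 * (x u + x v) \<le> B * (x u + x v)"
    using assms x_nonneg by (intro mult_right_mono) auto
  then show ?thesis using True uncut_nonneg[of u v] by simp
next
  case False
  have "\<mu> / 3 * (x u + x v) \<le> B * (x u + x v)"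
    using assms x_nonneg by (intro mult_right_mono) auto
  then show ?thesis using False uncut_ge[OF assms(1,2)] by simp
qed

lemma booksize_bound:
  assumes "0 < \<mu>" "\<mu> / 3 \<le> B" and "\<And>u v. adj u v \<Longrightarrow> codeg u v \<le> B"
  shows "\<mu> * (\<mu> - B) \<le> arc_sum (\<lambda>u v. 1) / 3"
proof -
  have nonneg: "0 \<le> (B - codeg u v) * (B * (x u + x v) - 1/3 + uncut u v)" if "adj u v" for u v
    using that assms adj_in[OF that] adj_in[OF adj_sym[OF that]]
    by (intro mult_nonneg_nonneg local_slack_nonneg) auto
  have "0 \<le> arc_sum (\<lambda>u v. (B - codeg u v) * (B * (x u + x v) - 1/3 + uncut u v))"
    unfolding arc_sum_def by (intro sum_nonneg) (simp add: nonneg)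
  also note arc_sum_slack_le
  \<comment> \<open>The factor \<open>B\<close> cancels because it is at least \<mu>/3, hence
    positive.\<close>
  finally have "0 \<le> 2/3 * arc_sum (\<lambda>u v. 1) - 2 * \<mu> * (\<mu> - B)"
    using assms(1,2) by (simp add: zero_le_mult_iff)
  then show ?thesis by simp
qed

text \<open>This is the equality case at \<open>B = \<mu> / 3\<close>: the bound on the number of
  arcs makes the right-hand side of \<open>arc_sum_slack_le\<close> nonpositive, so every summand
  vanishes. The strict bound on \<open>codeg\<close> transfers this to the second factor.\<close>

lemma adj_separates:
  assumes "0 < \<mu>" and codeg: "\<And>u v. adj u v \<Longrightarrow> codeg u v < \<mu> / 3"
    and arcs: "arc_sum (\<lambda>u v. 1) \<le> 2 * \<mu>\<^sup>2"
    and no_isolated: "\<And>v. v \<in> V \<Longrightarrow> \<exists>w. adj v w"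
    and "adj u v" "z \<in> V"
  shows "adj u z \<longleftrightarrow> \<not> adj v z"
proof -
  let ?B = "\<mu> / 3"
  have tight: "\<mu> * (x p + x q) = 1 \<and> uncut p q = 0" if pq: "adj p q" for p q
  proof -
    have V: "p \<in> V" "q \<in> V" using pq adj_in adj_sym by blast+
    have "?B * (2/3 * arc_sum (\<lambda>u v. 1) - 2 * \<mu> * (\<mu> - ?B)) \<le> 0"
      using arcs \<open>0 < \<mu>\<close> by (simp add: mult_le_0_iff power2_eq_square)
    with arc_sum_slack_le[of ?B]
    have le: "arc_sum (\<lambda>u v. (?B - codeg u v) * (?B * (x u + x v) - 1/3 + uncut u v)) \<le> 0"
      by linarith
    have nonneg: "0 \<le> (?B - codeg u v) * (?B * (x u + x v) - 1/3 + uncut u v)" if "adj u v" for u v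
      using codeg[OF that] that adj_in adj_sym \<open>0 < \<mu>\<close>
      by (intro mult_nonneg_nonneg local_slack_nonneg) (auto intro: less_imp_le)
    have "(?B - codeg p q) * (?B * (x p + x q) - 1/3 + uncut p q) = 0"
      using arc_sum_nonneg_eq_0[OF nonneg le pq] .
    then have "\<mu> * (x p + x q) / 3 - 1/3 + uncut p q = 0"
      using codeg[OF pq] by simp
    \<comment> \<open>With t = 1 - \<mu> (x p + x q), the uncut weight equals t/3 and is at least
      both 0 and t, which forces t = 0.\<close>
    then show ?thesis
      using uncut_nonneg[of p q] uncut_ge[OF V] by auto
  qed
  \<comment> \<open>A zero weight at \<open>z\<close> would spread to its neighbours by the
    eigenvalue equation, contradicting tightness on an edge at \<open>z\<close>.\<close>
  have "x z > 0"
  proof (rule ccontr)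
    assume "\<not> x z > 0"
    then have "x z = 0" using x_nonneg[OF \<open>z \<in> V\<close>] by simp
    then have "(\<Sum>w\<in>V. of_bool (adj z w) * x w) = 0"
      using eigen[OF \<open>z \<in> V\<close>] by simp
    moreover obtain w where w: "adj z w" using no_isolated \<open>z \<in> V\<close> by blast
    moreover have "w \<in> V" using w adj_in adj_sym by blast
    ultimately have "x w = 0"
      using fin by (subst (asm) sum_nonneg_eq_0_iff) (auto simp: x_nonneg)
    then show False using tight[OF w] \<open>x z = 0\<close> by simp
  qed
  moreover have "of_bool (adj u z = adj v z) * x z = 0"
    using tight[OF \<open>adj u v\<close>] \<open>z \<in> V\<close> fin x_nonneg unfolding uncut_def
    by (subst (asm) sum_nonneg_eq_0_iff) auto
  ultimately show ?thesis by auto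
qed

end

subsection \<open>Graphs\<close>

text \<open>The variational maximum \<mu> is an eigenvalue, hence at most the spectral radius.
  Conversely, the moduli of a complex eigenvector of largest modulus eigenvalue are a test vector
  for the quadratic form. Rescaling then turns unit square sum into unit sum.\<close>

lemma graph_perron_vector:
  assumes "graph G" and "verts G \<noteq> {}"
  obtains x where "\<And>v. v \<in> verts G \<Longrightarrow> 0 \<le> x v" and "(\<Sum>v\<in>verts G. x v) = 1"
    and "\<And>u. u \<in> verts G \<Longrightarrow>
      (\<Sum>v\<in>verts G. of_bool (u \<rightarrow>\<^bsub>G\<^esub> v) * x v) = graph_spectral_radius G * x u"
proof -
  interpret graph G by fact
  define V where "V = verts G"
  define n where "n = card V"
  define a :: "'a \<Rightarrow> 'a \<Rightarrow> real" where "a u v = of_bool (u \<rightarrow>\<^bsub>G\<^esub> v)" for u v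
  have fin: "finite V" and ne: "V \<noteq> {}" using assms by (auto simp: V_def)
  obtain f where f: "bij_betw f {..<n} V"
    using ex_bij_betw_nat_finite[OF fin] by (auto simp: n_def atLeast0LessThan)
  define A where "A = adjacency_matrix G f"
  define \<rho> where "\<rho> = graph_spectral_radius G"
  have \<rho>: "\<rho> = spectral_radius A"
    unfolding \<rho>_def A_def using f by (intro graph_spectral_radius_eq) (simp add: n_def V_def)
  have A: "A \<in> carrier_mat n n"
    by (simp add: A_def adjacency_matrix_def n_def V_def)
  have n0: "0 < n" using fin ne by (simp add: n_def card_gt_0_iff)
  have A_mult: "(A *\<^sub>v v) $ i = (\<Sum>j<n. complex_of_real (a (f i) (f j)) * v $ j)"
    if "i < n" "v \<in> carrier_vec n" for v i
    using that
    by (auto simp: A_def adjacency_matrix_def scalar_prod_def n_def V_def a_def atLeast0LessThan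
        intro!: sum.cong)
  have sum_f: "(\<Sum>j<n. h (f j)) = (\<Sum>v\<in>V. h v)" for h :: "'a \<Rightarrow> 'c :: comm_monoid_add"
    by (rule sum.reindex_bij_betw[OF f])
  have a_sym: "a u v = a v u" for u v
    by (simp add: a_def) (meson arcs_ends_symmetric sym_arcs)
  obtain x \<mu> where x: "\<And>v. v \<in> V \<Longrightarrow> 0 \<le> x v" "(\<Sum>v\<in>V. (x v)\<^sup>2) = 1"
    and eig: "\<And>u. u \<in> V \<Longrightarrow> (\<Sum>v\<in>V. a u v * x v) = \<mu> * x u"
    and max: "\<And>y. (\<Sum>u\<in>V. \<Sum>v\<in>V. a u v * (y u * y v)) \<le> \<mu> * (\<Sum>v\<in>V. (y v)\<^sup>2)"
    by (rule nonneg_symmetric_max_eigenvector[of V a]) (use fin ne a_sym in \<open>auto simp: a_def\<close>)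
  have f_in: "f i \<in> V" if "i < n" for i
    using f that by (auto simp: bij_betw_def)
  have "\<mu> \<le> \<rho>"
  proof -
    define v where "v = vec n (\<lambda>i. complex_of_real (x (f i)))"
    have v: "v \<in> carrier_vec n" by (simp add: v_def)
    have "A *\<^sub>v v = complex_of_real \<mu> \<cdot>\<^sub>v v"
    proof (rule eq_vecI)
      fix i assume "i < dim_vec (complex_of_real \<mu> \<cdot>\<^sub>v v)"
      then have i: "i < n" by (simp add: v_def)
      have "(A *\<^sub>v v) $ i = complex_of_real (\<Sum>j<n. a (f i) (f j) * x (f j))"
        using i by (simp add: A_mult v) (simp add: v_def)
      also have "\<dots> = complex_of_real (\<mu> * x (f i))"
        by (simp only: sum_f[of "\<lambda>w. a (f i) w * x w"] eig[OF f_in[OF i]])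
      finally show "(A *\<^sub>v v) $ i = (complex_of_real \<mu> \<cdot>\<^sub>v v) $ i"
        using i by (simp add: v_def)
    qed (use A in \<open>simp add: v_def\<close>)
    moreover have "v \<noteq> 0\<^sub>v n"
    proof
      assume v0: "v = 0\<^sub>v n"
      have "x (f i) = 0" if "i < n" for i
      proof -
        have "v $ i = 0" using v0 that by simp
        then show ?thesis using that by (simp add: v_def)
      qed
      then have "(\<Sum>i<n. (x (f i))\<^sup>2) = 0" by simp
      then show False using x(2) sum_f[of "\<lambda>w. (x w)\<^sup>2"] by simp
    qed
    ultimately have "complex_of_real \<mu> \<in> spectrum A"
      using A v by (auto simp: spectrum_def eigenvalue_def eigenvector_def)
    then have "norm (complex_of_real \<mu>) \<le> \<rho>"
      unfolding \<rho> by (intro spectral_radius_mem_max(2)[OF A n0] imageI)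
    then show ?thesis by simp
  qed
  moreover have "\<rho> \<le> \<mu>"
  proof -
    obtain k where "k \<in> spectrum A" and k: "\<rho> = norm k"
      using spectral_radius_mem_max(1)[OF A n0] unfolding \<rho> by blast
    then obtain v where v: "v \<in> carrier_vec n" "v \<noteq> 0\<^sub>v n" and ev: "A *\<^sub>v v = k \<cdot>\<^sub>v v"
      using A by (auto simp: spectrum_def eigenvalue_def eigenvector_def)
    define y where "y u = norm (v $ inv_into {..<n} f u)" for u
    have y: "y (f i) = norm (v $ i)" if "i < n" for i
      using that f by (simp add: y_def bij_betw_inv_into_left[OF f])
    \<comment> \<open>The triangle inequality in row \<open>i\<close> of the eigenvector
      equation.\<close>
    have *: "\<rho> * y u \<le> (\<Sum>w\<in>V. a u w * y w)" if "u \<in> V" for u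
    proof -
      obtain i where i: "i < n" "u = f i" using f \<open>u \<in> V\<close> by (auto simp: bij_betw_def)
      have "\<rho> * y u = norm ((A *\<^sub>v v) $ i)"
        using i v by (simp add: k y norm_mult ev)
      also have "\<dots> \<le> (\<Sum>j<n. a (f i) (f j) * y (f j))"
        unfolding A_mult[OF i(1) v(1)]
        by (rule order_trans[OF norm_sum]) (auto intro!: sum_mono simp: norm_mult y a_def)
      also have "\<dots> = (\<Sum>w\<in>V. a u w * y w)"
        unfolding i(2) by (rule sum_f)
      finally show ?thesis .
    qed
    have "\<rho> * (\<Sum>u\<in>V. (y u)\<^sup>2) = (\<Sum>u\<in>V. y u * (\<rho> * y u))"
      by (simp add: sum_distrib_left power2_eq_square mult_ac)
    also have "\<dots> \<le> (\<Sum>u\<in>V. y u * (\<Sum>w\<in>V. a u w * y w))"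
      by (intro sum_mono mult_left_mono *) (simp_all add: y_def)
    also have "\<dots> = (\<Sum>u\<in>V. \<Sum>w\<in>V. a u w * (y u * y w))"
      by (simp add: sum_distrib_left mult_ac)
    also note max
    finally have le: "\<rho> * (\<Sum>u\<in>V. (y u)\<^sup>2) \<le> \<mu> * (\<Sum>u\<in>V. (y u)\<^sup>2)" .
    have "\<exists>i<n. v $ i \<noteq> 0"
      using v by (auto intro!: eq_vecI)
    then obtain i where i: "i < n" "v $ i \<noteq> 0" by blast
    have "0 < (\<Sum>u\<in>V. (y u)\<^sup>2)"
      by (rule sum_pos2[OF fin f_in[OF i(1)]]) (use i in \<open>simp_all add: y\<close>)
    with le show ?thesis by simp
  qed
  ultimately have \<mu>: "\<mu> = \<rho>" by simp
  define s where "s = (\<Sum>v\<in>V. x v)"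
  have "s \<noteq> 0"
  proof
    assume "s = 0"
    then have "\<And>v. v \<in> V \<Longrightarrow> x v = 0"
      using fin x(1) by (simp add: s_def sum_nonneg_eq_0_iff)
    then show False using x(2) by simp
  qed
  moreover have "0 \<le> s" unfolding s_def by (intro sum_nonneg x)
  ultimately have s: "s > 0" by simp
  show thesis
  proof (rule that[of "\<lambda>v. x v / s"])
    show "0 \<le> x v / s" if "v \<in> verts G" for v
      using x(1) s that by (simp add: V_def)
    show "(\<Sum>v\<in>verts G. x v / s) = 1"
      using s by (simp add: sum_divide_distrib[symmetric] s_def V_def)
    show "(\<Sum>v\<in>verts G. of_bool (u \<rightarrow>\<^bsub>G\<^esub> v) * (x v / s)) = graph_spectral_radius G * (x u / s)"
      if "u \<in> verts G" for u
      using eig[of u] that by (simp add: a_def V_def \<mu> \<rho>_def sum_divide_distrib[symmetric])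
  qed
qed

text \<open>Each edge comes from exactly two arcs: symmetry supplies both orientations, and the
  absence of loops makes them distinct.\<close>

lemma card_arcs_ends_eq:
  assumes "graph G"
  shows "card (arcs_ends G) = 2 * card (uedges G)"
proof -
  interpret graph G by fact
  let ?e = "\<lambda>(u, v). {u, v}"
  have fin: "finite (arcs_ends G)" by (simp add: arcs_ends_conv)
  have img: "uedges G = ?e ` arcs_ends G" by (auto simp: uedges_def image_iff)
  have fibre: "card {p \<in> arcs_ends G. ?e p = e} = 2" if edge: "e \<in> uedges G" for e
  proof -
    obtain u v where e: "e = {u, v}" "u \<rightarrow>\<^bsub>G\<^esub> v" using edge unfolding uedges_def by blast
    then have "v \<rightarrow>\<^bsub>G\<^esub> u" "u \<noteq> v"
      using arcs_ends_symmetric[OF sym_arcs] adj_not_same by auto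
    with e have "{p \<in> arcs_ends G. ?e p = e} = {(u, v), (v, u)}"
      by (auto simp: doubleton_eq_iff)
    then show ?thesis using \<open>u \<noteq> v\<close> by simp
  qed
  have "card (arcs_ends G) = (\<Sum>e\<in>uedges G. card {p \<in> arcs_ends G. ?e p = e})"
    using sum.image_gen[OF fin, of "\<lambda>_. 1::nat" ?e] by (simp add: img)
  then show ?thesis using fibre by simp
qed

lemma card_common_nbrs_le_booksize:
  assumes "graph G" and "u \<rightarrow>\<^bsub>G\<^esub> v"
  shows "card (nbrs G u \<inter> nbrs G v) \<le> booksize G"
proof -
  interpret graph G by fact
  have "finite ((\<lambda>(u, v). card (nbrs G u \<inter> nbrs G v)) ` arcs_ends G)"
    by (simp add: arcs_ends_conv)
  moreover have "{card (nbrs G u \<inter> nbrs G v) | u v. u \<rightarrow>\<^bsub>G\<^esub> v}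
      = (\<lambda>(u, v). card (nbrs G u \<inter> nbrs G v)) ` arcs_ends G"
    by (auto simp: image_iff)
  ultimately show ?thesis
    unfolding booksize_def using assms(2) by (intro Max_ge) auto
qed

text \<open>The two sides are \<open>nbrs G u\<close> and \<open>nbrs G v\<close>: the hypothesis at
  the edge \<open>uv\<close> says that they partition the vertices.\<close>

lemma complete_bipartiteI:
  assumes "graph G" and "u \<rightarrow>\<^bsub>G\<^esub> v"
    and sep: "\<And>p q z. p \<rightarrow>\<^bsub>G\<^esub> q \<Longrightarrow> z \<in> verts G \<Longrightarrow> p \<rightarrow>\<^bsub>G\<^esub> z \<longleftrightarrow> \<not> q \<rightarrow>\<^bsub>G\<^esub> z"
  shows "\<exists>a b. complete_bipartite_digraph a b G"
proof -
  interpret graph G by fact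
  have sym: "q \<rightarrow>\<^bsub>G\<^esub> p" if "p \<rightarrow>\<^bsub>G\<^esub> q" for p q
    using arcs_ends_symmetric[OF sym_arcs that] .
  have "verts G = nbrs G u \<union> nbrs G v"
    using sep[OF assms(2)] by (auto simp: nbrs_def dest: adj_in_verts)
  moreover have "nbrs G u \<inter> nbrs G v = {}"
    using sep[OF assms(2)] by (auto simp: nbrs_def dest: adj_in_verts)
  moreover have "arcs_ends G = nbrs G u \<times> nbrs G v \<union> nbrs G v \<times> nbrs G u"
  proof -
    \<comment> \<open>Separation of \<open>p\<close> from \<open>q\<close> at the vertex
      \<open>u\<close> puts them on different sides.\<close>
    have "u \<rightarrow>\<^bsub>G\<^esub> p \<and> v \<rightarrow>\<^bsub>G\<^esub> q \<or> v \<rightarrow>\<^bsub>G\<^esub> p \<and> u \<rightarrow>\<^bsub>G\<^esub> q" if pq: "p \<rightarrow>\<^bsub>G\<^esub> q" for p q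
      using sep[OF assms(2) adj_in_verts(1)[OF pq]] sep[OF assms(2) adj_in_verts(2)[OF pq]]
        sep[OF pq adj_in_verts(1)[OF assms(2)]] sym[of p u] sym[of u p] sym[of q u] sym[of u q]
      by argo
    \<comment> \<open>Since \<open>v\<close> is adjacent to \<open>q\<close>, \<open>u\<close> is
      not; separation of the edge \<open>up\<close> at \<open>q\<close> then makes \<open>p\<close>
      adjacent to \<open>q\<close>.\<close>
    moreover have "p \<rightarrow>\<^bsub>G\<^esub> q" if "u \<rightarrow>\<^bsub>G\<^esub> p" "v \<rightarrow>\<^bsub>G\<^esub> q" for p q
      using sep[OF that(1) adj_in_verts(2)[OF that(2)]]
        sep[OF assms(2) adj_in_verts(2)[OF that(2)]] that by argo
    ultimately have "p \<rightarrow>\<^bsub>G\<^esub> q \<longleftrightarrow> (p, q) \<in> nbrs G u \<times> nbrs G v \<union> nbrs G v \<times> nbrs G u" for p q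
      unfolding nbrs_def using sym[of q p] by blast
    then show ?thesis by (intro equalityI subrelI) blast+
  qed
  ultimately show ?thesis
    unfolding complete_bipartite_digraph_def using assms(1) by blast
qed

theorem theorem1p5:
  fixes G :: "('a, 'b) pre_digraph" and m :: nat and \<rho> :: real
  assumes "graph G"
    and "\<forall>v \<in> verts G. nbrs G v \<noteq> {}"
    and "m = card (uedges G)" and "m \<ge> 1"
    and "\<rho> = graph_spectral_radius G" and "\<rho> \<ge> sqrt (real m)"
    and "\<not> (\<exists>a b. complete_bipartite_digraph a b G)"
  shows "real (booksize G) \<ge> \<rho> - 2 * real m / (3 * \<rho>)"
proof -
  interpret graph G by fact
  have "uedges G \<noteq> {}" using assms(3,4) by auto
  then obtain u v where uv: "u \<rightarrow>\<^bsub>G\<^esub> v" by (auto simp: uedges_def)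
  then have ne: "verts G \<noteq> {}" using adj_in_verts by blast
  obtain x where x: "\<And>v. v \<in> verts G \<Longrightarrow> 0 \<le> x v" "(\<Sum>v\<in>verts G. x v) = 1"
    "\<And>u. u \<in> verts G \<Longrightarrow> (\<Sum>v\<in>verts G. of_bool (u \<rightarrow>\<^bsub>G\<^esub> v) * x v) = graph_spectral_radius G * x u"
    by (rule graph_perron_vector[OF assms(1) ne]) (rule that)
  interpret perron_weights "verts G" "\<lambda>u v. u \<rightarrow>\<^bsub>G\<^esub> v" x \<rho>
    by unfold_locales
      (use x[folded assms(5)] arcs_ends_symmetric[OF sym_arcs] adj_in_verts in auto)
  have pos: "0 < \<rho>" using assms(4,6) by (smt (verit) real_sqrt_ge_one of_nat_1 of_nat_mono)
  have m_le: "real m \<le> \<rho>\<^sup>2"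
    using assms(6) pos by (simp add: real_le_lsqrt sqrt_le_D)
  have arcs: "arc_sum (\<lambda>u v. 1) = 2 * real m"
  proof -
    have "arcs_ends G = {p \<in> verts G \<times> verts G. p \<in> arcs_ends G}"
      using adj_in_verts by auto
    then have "real (card (arcs_ends G)) = (\<Sum>p\<in>verts G \<times> verts G. of_bool (p \<in> arcs_ends G))"
      by (simp add: Int_def)
    also have "\<dots> = arc_sum (\<lambda>u v. 1)"
      by (simp only: arc_sum_def sum.cartesian_product case_prod_unfold mult_1_right prod.collapse)
    finally show ?thesis
      using card_arcs_ends_eq[OF assms(1)] assms(3) by simp
  qed
  have codeg: "codeg p q \<le> real (booksize G)" if "p \<rightarrow>\<^bsub>G\<^esub> q" for p q
    using card_common_nbrs_le_booksize[OF assms(1) that]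
    by (simp add: codeg_def nbrs_def Collect_conj_eq)
  show ?thesis
  \<comment> \<open>The threshold \<rho>/3 is what \<open>booksize_bound\<close> requires of
    \<open>B\<close>; below it, all codegrees are strictly less than \<rho>/3, as
    \<open>adj_separates\<close> demands.\<close>
  proof (cases "\<rho> / 3 \<le> real (booksize G)")
    case True
    then have "\<rho> * (\<rho> - real (booksize G)) \<le> 2 * real m / 3"
      using booksize_bound[OF pos True codeg] by (simp add: arcs)
    then show ?thesis using pos by (simp add: field_simps)
  next
    case False
    have "p \<rightarrow>\<^bsub>G\<^esub> z \<longleftrightarrow> \<not> q \<rightarrow>\<^bsub>G\<^esub> z" if "p \<rightarrow>\<^bsub>G\<^esub> q" "z \<in> verts G" for p q z
    proof (rule adj_separates[OF pos _ _ _ that])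
      show "codeg u v < \<rho> / 3" if "u \<rightarrow>\<^bsub>G\<^esub> v" for u v
        using codeg[OF that] False by simp
      show "arc_sum (\<lambda>u v. 1) \<le> 2 * \<rho>\<^sup>2" using m_le by (simp add: arcs)
      show "\<exists>w. v \<rightarrow>\<^bsub>G\<^esub> w" if "v \<in> verts G" for v
        using assms(2) that by (auto simp: nbrs_def)
    qed
    then show ?thesis
      using complete_bipartiteI[OF assms(1) uv] assms(7) by blast
  qed
qed

end
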